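(* Let $G=(V,E)$ be a graph with $n$ nodes and let $V_1,V_2$ be a (planted) bisection of $V$, with associated parameters $d_{\mathrm{in}}$ and $d_{\mathrm{out}}$. If $d_{\mathrm{in}}-d_{\mathrm{out}}>n/4-1$, then the minimum bisection problem on $G$ recovers the planted bisection, i.e. $\{V_1,V_2\}$ is the unique bisection of $V$ of minimum cost.
   Context: Graphs are finite, simple and undirected, with $V=\{1,\dots,n\}$. A bisection of $V$ is a partition of $V$ into two subsets of equal cardinality (so $n$ is even); its cost is the number of edges of $G$ connecting the two sets. The minimum bisection problem asks for a bisection of minimum cost. A bisection $V_1,V_2$ is fixed and called the planted bisection; an optimization problem recovers the planted bisection if its unique optimal solution corresponds to the planted bisection. $G[U]$ denotes the subgraph of $G$ induced by $U\subseteq V$. Let $G_0=(V,E_0)$, where $E_0$ is the set of edges of $G$ with one end in $V_1$ and the other in $V_2$. The parameter $d_{\mathrm{in}}$ is the minimum degree of the nodes of $G[V_1]\cup G[V_2]$ (i.e. the minimum over $v\in V$ of the number of neighbors of $v$ in its own part), and $d_{\mathrm{out}}$ is the maximum degree of the nodes of $G_0$ (i.e. the maximum over $v\in V$ of the number of neighbors of $v$ in the other part). *)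

theory Defs
  imports Complex_Main "HOL-Library.Disjoint_Sets"
begin

definition simple_graph :: "'a set \<Rightarrow> 'a set set \<Rightarrow> bool" where
  "simple_graph V E \<longleftrightarrow> finite V \<and> (\<forall>e\<in>E. e \<subseteq> V \<and> card e = 2)"

definition degree :: "'a set set \<Rightarrow> 'a \<Rightarrow> nat" where
  "degree E v = card {e \<in> E. v \<in> e}"

definition min_degree :: "'a set \<Rightarrow> 'a set set \<Rightarrow> nat" where
  "min_degree V E = Min (degree E ` V)"

definition max_degree :: "'a set \<Rightarrow> 'a set set \<Rightarrow> nat" where
  "max_degree V E = Max (degree E ` V)"

definition induced_edges :: "'a set set \<Rightarrow> 'a set \<Rightarrow> 'a set set" where
  "induced_edges E U = {e \<in> E. e \<subseteq> U}"

text \<open>A bisection is unordered: it is the set of its two parts.  The parts of a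
  \<^const>\<open>partition_on\<close> are nonempty, so the empty vertex set, on which
  \<^const>\<open>min_degree\<close> and \<^const>\<open>max_degree\<close> are unspecified, has no bisection.\<close>

definition bisection :: "'a set \<Rightarrow> 'a set set \<Rightarrow> bool" where
  "bisection V P \<longleftrightarrow> partition_on V P \<and> card P = 2 \<and> (\<forall>A\<in>P. \<forall>B\<in>P. card A = card B)"

definition crossing_edges :: "'a set set \<Rightarrow> 'a set set \<Rightarrow> 'a set set" where
  "crossing_edges E P = {e \<in> E. \<exists>A\<in>P. \<exists>B\<in>P. A \<noteq> B \<and> (\<exists>a\<in>A. \<exists>b\<in>B. e = {a, b})}"

definition bisection_cost :: "'a set set \<Rightarrow> 'a set set \<Rightarrow> nat" where
  "bisection_cost E P = card (crossing_edges E P)"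

definition d_in :: "'a set \<Rightarrow> 'a set set \<Rightarrow> 'a set set \<Rightarrow> nat" where
  "d_in V E P = min_degree V (\<Union>U\<in>P. induced_edges E U)"

definition d_out :: "'a set \<Rightarrow> 'a set set \<Rightarrow> 'a set set \<Rightarrow> nat" where
  "d_out V E P = max_degree V (crossing_edges E P)"

definition min_bisection :: "'a set \<Rightarrow> 'a set set \<Rightarrow> 'a set set \<Rightarrow> bool" where
  "min_bisection V E = is_arg_min (bisection_cost E) (bisection V)"

lemma bisection_doubleton_iff:
  assumes "V \<noteq> {}" and "finite V"
  shows "bisection V {A, B} \<longleftrightarrow> A \<union> B = V \<and> A \<inter> B = {} \<and> card A = card B"
proof
  assume *: "bisection V {A, B}"
  then have "card {A, B} = 2" "card A = card B" and p: "partition_on V {A, B}"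
    unfolding bisection_def by blast+
  then have "A \<noteq> B" by auto
  then show "A \<union> B = V \<and> A \<inter> B = {} \<and> card A = card B"
    using partition_onD1[OF p] disjointD[OF partition_onD2[OF p], of A B] \<open>card A = card B\<close> by blast
next
  assume *: "A \<union> B = V \<and> A \<inter> B = {} \<and> card A = card B"
  have "finite A" "finite B" using * assms(2) by (metis finite_Un)+
  then have ne: "A \<noteq> {}" "B \<noteq> {}" using * assms(1) by auto
  then have "A \<noteq> B" using * by blast
  then have "card {A, B} = 2" by simp
  moreover have "partition_on V {A, B}"
    using * ne unfolding partition_on_def disjoint_def by blast
  ultimately show "bisection V {A, B}"
    using * unfolding bisection_def by (metis empty_iff insert_iff)
qed

end

(* Let B be part of V1 and C part of V2 with card B = card C = k, and let a second bisection arise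
   from {V1, V2} by exchanging B and C; swapping the names of its two parts if necessary,
   k \<le> n/4.  Write A = V1 - B and D = V2 - C.  The A-D and B-C edges cross both bisections, so
   the cost grows by e(A,B) + e(C,D) - e(A,C) - e(B,D).  A node of B has at most k - 1 neighbours
   in B, hence at least d_in - (k - 1) in A, and at most d_out in D; likewise for C.  The growth is
   therefore at least 2k (d_in - d_out - (k - 1)) > 2k (n/4 - k) \<ge> 0. *)
theory Submission
  imports Defs
begin

definition nbrs :: "'a set set \<Rightarrow> 'a \<Rightarrow> 'a set \<Rightarrow> 'a set" where
  "nbrs E v S = {u \<in> S. {v, u} \<in> E}"

text \<open>This is e(X, Y) of the overview when \<open>X\<close> and \<open>Y\<close> are disjoint.
  Being a sum of neighbour counts, it splits over disjoint unions in either argument and can be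
  bounded node by node.\<close>

definition edge_count :: "'a set set \<Rightarrow> 'a set \<Rightarrow> 'a set \<Rightarrow> nat" where
  "edge_count E X Y = (\<Sum>x\<in>X. card (nbrs E x Y))"

lemma card_nbrs_Un:
  assumes "finite X" "finite Y" "X \<inter> Y = {}"
  shows "card (nbrs E v (X \<union> Y)) = card (nbrs E v X) + card (nbrs E v Y)"
proof -
  have "nbrs E v (X \<union> Y) = nbrs E v X \<union> nbrs E v Y" by (auto simp: nbrs_def)
  moreover have "finite (nbrs E v X)" "finite (nbrs E v Y)" "nbrs E v X \<inter> nbrs E v Y = {}"
    using assms by (auto simp: nbrs_def)
  ultimately show ?thesis by (simp add: card_Un_disjoint)
qed

lemma edge_count_Un_right:
  assumes "finite X" "finite Y" "X \<inter> Y = {}"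
  shows "edge_count E S (X \<union> Y) = edge_count E S X + edge_count E S Y"
  unfolding edge_count_def card_nbrs_Un[OF assms] by (rule sum.distrib)

lemma edge_count_Un_left:
  assumes "finite X" "finite Y" "X \<inter> Y = {}"
  shows "edge_count E (X \<union> Y) S = edge_count E X S + edge_count E Y S"
  unfolding edge_count_def by (rule sum.union_disjoint[OF assms])

text \<open>Counting ordered pairs makes the symmetry in \<open>X\<close> and \<open>Y\<close>
  visible and gives a set that can be put in bijection with the crossing edges.\<close>

lemma edge_count_eq_card:
  assumes "finite X" "finite Y"
  shows "edge_count E X Y = card {(x, y). x \<in> X \<and> y \<in> Y \<and> {x, y} \<in> E}"
proof -
  have "{(x, y). x \<in> X \<and> y \<in> Y \<and> {x, y} \<in> E} = (SIGMA x:X. nbrs E x Y)"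
    by (auto simp: nbrs_def)
  moreover have "\<forall>x\<in>X. finite (nbrs E x Y)" using assms by (simp add: nbrs_def)
  ultimately show ?thesis using assms by (simp add: edge_count_def card_SigmaI)
qed

lemma edge_count_commute:
  assumes "finite X" "finite Y"
  shows "edge_count E X Y = edge_count E Y X"
proof -
  have "bij_betw (\<lambda>(x, y). (y, x)) {(x, y). x \<in> X \<and> y \<in> Y \<and> {x, y} \<in> E}
      {(x, y). x \<in> Y \<and> y \<in> X \<and> {x, y} \<in> E}"
    by (rule bij_betwI[where g = "\<lambda>(x, y). (y, x)"]) (auto simp: insert_commute)
  then show ?thesis using assms by (simp add: edge_count_eq_card bij_betw_same_card)
qed

text \<open>The map u \<mapsto> {v, u} is injective, and every edge at \<open>v\<close> is in its
  range because edges have two elements. This turns degrees, which count edges, into counts of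
  neighbours.\<close>

lemma degree_eq_card:
  assumes "\<And>e. e \<in> F \<Longrightarrow> card e = 2"
  shows "degree F v = card {u. {v, u} \<in> F}"
proof -
  have "bij_betw (\<lambda>u. {v, u}) {u. {v, u} \<in> F} {e \<in> F. v \<in> e}"
  proof (rule bij_betw_imageI)
    show "inj_on (\<lambda>u. {v, u}) {u. {v, u} \<in> F}"
      by (auto simp: inj_on_def doubleton_eq_iff)
    show "(\<lambda>u. {v, u}) ` {u. {v, u} \<in> F} = {e \<in> F. v \<in> e}"
    proof (intro equalityI subsetI)
      fix e assume e: "e \<in> {e \<in> F. v \<in> e}"
      then obtain x y where "e = {x, y}" using assms by (fastforce simp: card_2_iff)
      with e show "e \<in> (\<lambda>u. {v, u}) ` {u. {v, u} \<in> F}" by (auto simp: insert_commute)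
    qed auto
  qed
  then show ?thesis by (simp add: degree_def bij_betw_same_card)
qed

lemma crossing_edges_doubleton:
  assumes "X \<noteq> Y"
  shows "crossing_edges E {X, Y} = {e \<in> E. \<exists>x\<in>X. \<exists>y\<in>Y. e = {x, y}}"
proof -
  have "{a, b} = {b, a}" for a b :: 'a by auto
  then show ?thesis using assms unfolding crossing_edges_def by (auto; metis)
qed

text \<open>Disjointness lets the ordered pair be recovered from a crossing edge: its first
  component is the end in \<open>X\<close>. So no edge is counted twice.\<close>

lemma bisection_cost_eq_edge_count:
  assumes "finite X" "finite Y" "X \<inter> Y = {}" "X \<noteq> Y"
  shows "bisection_cost E {X, Y} = edge_count E X Y"
proof -
  have "bij_betw (\<lambda>(x, y). {x, y}) {(x, y). x \<in> X \<and> y \<in> Y \<and> {x, y} \<in> E}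
      {e \<in> E. \<exists>x\<in>X. \<exists>y\<in>Y. e = {x, y}}"
    using assms(3) by (intro bij_betw_imageI) (auto simp: inj_on_def doubleton_eq_iff)
  then show ?thesis
    using assms
    by (simp add: bisection_cost_def crossing_edges_doubleton edge_count_eq_card
        bij_betw_same_card)
qed

lemma bisection_cases:
  assumes "bisection V P" "finite V"
  obtains X Y where "P = {X, Y}" "X \<noteq> Y" "X \<inter> Y = {}" "X \<union> Y = V" "card X = card Y"
    "finite X" "finite Y"
proof -
  from assms obtain X Y where P: "P = {X, Y}" "X \<noteq> Y"
    unfolding bisection_def by (auto simp: card_2_iff)
  with assms have "V \<noteq> {}" unfolding bisection_def partition_on_def by auto
  with P assms bisection_doubleton_iff[of V X Y]
  have "X \<union> Y = V" "X \<inter> Y = {}" "card X = card Y" by auto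
  with P assms(2) that show thesis by (metis finite_Un)
qed

lemma d_in_le:
  assumes G: "simple_graph V E" and XY: "X \<inter> Y = {}" "X \<union> Y = V" and v: "v \<in> X"
  shows "d_in V E {X, Y} \<le> card (nbrs E v X)"
proof -
  let ?F = "\<Union>U\<in>{X, Y}. induced_edges E U"
  have "\<And>e. e \<in> ?F \<Longrightarrow> card e = 2" using G by (auto simp: simple_graph_def induced_edges_def)
  then have "degree ?F v = card {u. {v, u} \<in> ?F}" by (rule degree_eq_card)
  \<comment> \<open>An edge at \<open>v\<close> inside one of the parts must lie inside
    \<open>X\<close>, since \<open>Y\<close> does not contain \<open>v\<close>.\<close>
  also have "{u. {v, u} \<in> ?F} = nbrs E v X"
    using XY v by (auto simp: induced_edges_def nbrs_def)
  finally have "degree ?F v = card (nbrs E v X)" .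
  moreover have "d_in V E {X, Y} \<le> degree ?F v"
    unfolding d_in_def min_degree_def using G XY v by (auto simp: simple_graph_def intro!: Min_le)
  ultimately show ?thesis by simp
qed

lemma le_d_out:
  assumes G: "simple_graph V E" and XY: "X \<inter> Y = {}" "X \<union> Y = V" and v: "v \<in> X"
  shows "card (nbrs E v Y) \<le> d_out V E {X, Y}"
proof -
  let ?F = "crossing_edges E {X, Y}"
  have "X \<noteq> Y" using XY v by auto
  then have F: "?F = {e \<in> E. \<exists>x\<in>X. \<exists>y\<in>Y. e = {x, y}}" by (rule crossing_edges_doubleton)
  have "\<And>e. e \<in> ?F \<Longrightarrow> card e = 2" using G by (auto simp: simple_graph_def crossing_edges_def)
  then have "degree ?F v = card {u. {v, u} \<in> ?F}" by (rule degree_eq_card)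
  also have "{u. {v, u} \<in> ?F} = nbrs E v Y"
    unfolding F using XY v by (auto simp: nbrs_def doubleton_eq_iff)
  finally have "degree ?F v = card (nbrs E v Y)" .
  moreover have "degree ?F v \<le> d_out V E {X, Y}"
    unfolding d_out_def max_degree_def using G XY v by (auto simp: simple_graph_def intro!: Max_ge)
  ultimately show ?thesis by simp
qed

text \<open>One half of the exchange: \<open>T\<close> changes sides, \<open>S\<close> is the rest
  of its own part, and \<open>R\<close> is what stays in the opposite part. The bound holds for each
  node of \<open>T\<close> and is then summed over \<open>T\<close>; it is stated over the reals
  because the differences may be negative.\<close>

lemma edge_count_exchange_part:
  assumes fin: "finite S" "finite T" "finite R" and disj: "S \<inter> T = {}"
    and no_loop: "\<And>v. {v} \<notin> E"
    and d: "\<And>v. v \<in> T \<Longrightarrow> d \<le> card (nbrs E v (S \<union> T))"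
    and d': "\<And>v. v \<in> T \<Longrightarrow> card (nbrs E v R) \<le> d'"
  shows "real (card T) * (real d - real d' - (real (card T) - 1))
    \<le> real (edge_count E T S) - real (edge_count E T R)"
proof -
  have "real d - real d' - (real (card T) - 1) \<le> real (card (nbrs E v S)) - real (card (nbrs E v R))"
    if v: "v \<in> T" for v
  proof -
    \<comment> \<open>Without loops \<open>v\<close> is not its own neighbour; this saves the 1 that
      appears in the threshold n/4 - 1.\<close>
    have "nbrs E v T \<subseteq> T - {v}" using no_loop by (auto simp: nbrs_def)
    then have "card (nbrs E v T) \<le> card (T - {v})" using fin by (intro card_mono) auto
    moreover have "card (T - {v}) + 1 = card T" using v fin by (metis Suc_eq_plus1 card.remove)
    ultimately show ?thesis
      using d[OF v] d'[OF v] unfolding card_nbrs_Un[OF fin(1,2) disj] by linarith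
  qed
  then have "(\<Sum>v\<in>T. real d - real d' - (real (card T) - 1))
      \<le> (\<Sum>v\<in>T. real (card (nbrs E v S)) - real (card (nbrs E v R)))" by (rule sum_mono)
  then show ?thesis by (simp add: edge_count_def sum_subtractf)
qed

text \<open>Adds the one-sided bounds for \<open>B\<close> and for \<open>C\<close>, each of which
  is strictly positive.\<close>

lemma edge_count_exchange:
  assumes fin: "finite A" "finite B" "finite C" "finite D"
    and disj: "(A \<union> B) \<inter> (C \<union> D) = {}" "A \<inter> B = {}" "C \<inter> D = {}"
    and k: "card B = k" "card C = k" "0 < k"
    and no_loop: "\<And>v. {v} \<notin> E"
    and dB: "\<And>v. v \<in> B \<Longrightarrow> d \<le> card (nbrs E v (A \<union> B))"
      "\<And>v. v \<in> B \<Longrightarrow> card (nbrs E v (C \<union> D)) \<le> d'"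
    and dC: "\<And>v. v \<in> C \<Longrightarrow> d \<le> card (nbrs E v (C \<union> D))"
      "\<And>v. v \<in> C \<Longrightarrow> card (nbrs E v (A \<union> B)) \<le> d'"
    and gap: "real d - real d' > real k - 1"
  shows "edge_count E (A \<union> B) (C \<union> D) < edge_count E (A \<union> C) (B \<union> D)"
proof -
  let ?e = "\<lambda>X Y. real (edge_count E X Y)"
  \<comment> \<open>The bound \<open>d'\<close> covers neighbours in all of \<open>C\<close>
    \<union> \<open>D\<close>; only those in \<open>D\<close> enter, as edges from \<open>B\<close>
    to \<open>C\<close> are cut before and after the exchange.\<close>
  have "card (nbrs E v D) \<le> d'" if "v \<in> B" for v
    using dB(2)[OF that] card_nbrs_Un[OF fin(3,4) disj(3), of E v] by simp
  then have B: "real k * (real d - real d' - (real k - 1)) \<le> ?e B A - ?e B D"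
    using edge_count_exchange_part[of A B D E d d'] fin disj no_loop dB(1) k(1) by simp
  have "card (nbrs E v A) \<le> d'" if "v \<in> C" for v
    using dC(2)[OF that] card_nbrs_Un[OF fin(1,2) disj(2), of E v] by simp
  moreover have "d \<le> card (nbrs E v (D \<union> C))" if "v \<in> C" for v
    using dC(1)[OF that] by (simp add: Un_commute)
  ultimately have C: "real k * (real d - real d' - (real k - 1)) \<le> ?e C D - ?e C A"
    using edge_count_exchange_part[of D C A E d d'] fin disj no_loop k(2) by (simp add: Int_commute)
  have "0 < real k * (real d - real d' - (real k - 1))" using k(3) gap by simp
  moreover have "A \<inter> C = {}" "B \<inter> D = {}" using disj by auto
  \<comment> \<open>After the symmetries below, the A-D and B-C terms agree in both expansions and
    cancel.\<close>
  then have "edge_count E (A \<union> B) (C \<union> D)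
      = edge_count E A C + edge_count E A D + (edge_count E B C + edge_count E B D)"
    "edge_count E (A \<union> C) (B \<union> D)
      = edge_count E A B + edge_count E A D + (edge_count E C B + edge_count E C D)"
    using fin disj by (simp_all add: edge_count_Un_left edge_count_Un_right)
  moreover have "edge_count E A B = edge_count E B A" "edge_count E A C = edge_count E C A"
    "edge_count E B C = edge_count E C B"
    using fin by (simp_all add: edge_count_commute)
  ultimately show ?thesis using B C by linarith
qed

text \<open>Any two bisections differ by an exchange: intersecting their parts yields the sets
  \<open>A\<close>, \<open>B\<close>, \<open>C\<close>, \<open>D\<close> of the overview, with
  \<open>V1\<close> \<inter> \<open>W2\<close> as the set \<open>B\<close>.\<close>

lemma planted_cost_less:
  assumes G: "simple_graph V E"
    and V12: "V1 \<inter> V2 = {}" "V1 \<union> V2 = V" "card V1 = card V2"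
    and W: "W1 \<inter> W2 = {}" "W1 \<union> W2 = V" "card W1 = card W2" "{W1, W2} \<noteq> {V1, V2}"
    and small: "4 * card (V1 \<inter> W2) \<le> card V"
    and gap: "real (d_in V E {V1, V2}) - real (d_out V E {V1, V2}) > real (card V) / 4 - 1"
  shows "edge_count E V1 V2 < edge_count E W1 W2"
proof -
  let ?A = "V1 \<inter> W1" and ?B = "V1 \<inter> W2" and ?C = "V2 \<inter> W1" and ?D = "V2 \<inter> W2"
  have fin: "finite V" using G by (simp add: simple_graph_def)
  then have fins: "finite V1" "finite V2" "finite W1" "finite W2"
    using V12(2) W(2) by (metis finite_Un)+
  have eqs: "?A \<union> ?B = V1" "?C \<union> ?D = V2" "?A \<union> ?C = W1" "?B \<union> ?D = W2"
    using V12 W by auto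
  have "?A \<inter> ?B = {}" "?A \<inter> ?C = {}" using V12(1) W(1) by auto
  then have "card V1 = card ?A + card ?B" "card W1 = card ?A + card ?C"
    using card_Un_disjoint[of ?A ?B] card_Un_disjoint[of ?A ?C] eqs fins by simp_all
  moreover have "card V = 2 * card V1" "card V = 2 * card W1"
    using card_Un_disjoint[of V1 V2] card_Un_disjoint[of W1 W2] fins V12 W by auto
  \<comment> \<open>\<open>V1\<close> and \<open>W1\<close> both have n/2 nodes and share
    \<open>?A\<close>, so what remains of each has the same size.\<close>
  ultimately have BC: "card ?C = card ?B" by linarith
  have "0 < card ?B"
  proof (rule ccontr)
    assume "\<not> 0 < card ?B"
    with BC fins have "?B = {}" "?C = {}" by auto
    with eqs have "W1 = V1" "W2 = V2" by auto
    with W(4) show False by simp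
  qed
  moreover have "{v} \<notin> E" for v using G by (fastforce simp: simple_graph_def)
  moreover have "real (d_in V E {V1, V2}) - real (d_out V E {V1, V2}) > real (card ?B) - 1"
    using gap small by linarith
  moreover have "d_in V E {V1, V2} \<le> card (nbrs E v V1)" "card (nbrs E v V2) \<le> d_out V E {V1, V2}"
    if "v \<in> V1" for v
    using d_in_le[OF G V12(1,2) that] le_d_out[OF G V12(1,2) that] .
  moreover have "d_in V E {V1, V2} \<le> card (nbrs E v V2)" "card (nbrs E v V1) \<le> d_out V E {V1, V2}"
    if "v \<in> V2" for v
    using d_in_le[OF G _ _ that, of V1] le_d_out[OF G _ _ that, of V1] V12
    by (simp_all add: Int_commute Un_commute insert_commute)
  ultimately show ?thesis
    using edge_count_exchange[of ?A ?B ?C ?D "card ?B" E "d_in V E {V1, V2}" "d_out V E {V1, V2}"]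
      fins V12(1) W(1) BC unfolding eqs by blast
qed

theorem theorem1:
  fixes n :: nat and V V1 V2 :: "nat set" and E :: "nat set set"
  assumes "V = {1..n}"
    and "simple_graph V E"
    and "bisection V {V1, V2}"
    and "real (d_in V E {V1, V2}) - real (d_out V E {V1, V2}) > real n / 4 - 1"
  shows "\<forall>P. min_bisection V E P \<longleftrightarrow> P = {V1, V2}"
proof -
  have fin: "finite V" and n: "card V = n" using assms(1) by auto
  have gap: "real (d_in V E {V1, V2}) - real (d_out V E {V1, V2}) > real (card V) / 4 - 1"
    using assms(4) n by simp
  \<comment> \<open>The parts of a partition are nonempty, so the case n = 0 cannot arise.\<close>
  have "V \<noteq> {}" using assms(3) unfolding bisection_def partition_on_def by auto
  then have V12: "V1 \<inter> V2 = {}" "V1 \<union> V2 = V" "card V1 = card V2"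
    using assms(3) bisection_doubleton_iff[OF _ fin] by auto
  then have V12': "V1 \<noteq> V2" "finite V1" "finite V2" using fin \<open>V \<noteq> {}\<close> by auto
  have less: "bisection_cost E {V1, V2} < bisection_cost E P"
    if P: "bisection V P" "P \<noteq> {V1, V2}" for P
  proof -
    obtain X Y where XY: "P = {X, Y}" "X \<noteq> Y" "X \<inter> Y = {}" "X \<union> Y = V" "card X = card Y"
      "finite X" "finite Y"
      using bisection_cases[OF P(1) fin] .
    have "V1 = (V1 \<inter> X) \<union> (V1 \<inter> Y)" using XY V12 by auto
    then have "card V1 = card (V1 \<inter> X) + card (V1 \<inter> Y)"
      using card_Un_disjoint[of "V1 \<inter> X" "V1 \<inter> Y"] XY by auto
    moreover have "card V = 2 * card V1" using card_Un_disjoint[of V1 V2] V12 V12' by simp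
    \<comment> \<open>\<open>X\<close> and \<open>Y\<close> split the n/2 nodes of
      \<open>V1\<close>, so one of them contains at most n/4 of these. That one takes the role of
      \<open>W2\<close>, and the second case therefore swaps the two names.\<close>
    ultimately consider "4 * card (V1 \<inter> Y) \<le> card V" | "4 * card (V1 \<inter> X) \<le> card V" by linarith
    then have "edge_count E V1 V2 < edge_count E X Y"
    proof cases
      case 1
      then show ?thesis using planted_cost_less[OF assms(2) V12 XY(3-5) _ _ gap] P(2) XY(1) by simp
    next
      case 2
      then have "edge_count E V1 V2 < edge_count E Y X"
        using planted_cost_less[OF assms(2) V12 _ _ _ _ _ gap, of Y X] P(2) XY
        by (simp add: Int_commute Un_commute insert_commute)
      then show ?thesis using edge_count_commute[OF XY(6,7)] by simp
    qed
    then show ?thesis using XY V12 V12' by (simp add: bisection_cost_eq_edge_count)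
  qed
  show ?thesis
    \<comment> \<open>Strict inequality against every other bisection gives both the optimality of
      the planted one and its uniqueness.\<close>
    unfolding min_bisection_def is_arg_min_def using less assms(3) by (metis less_asym)
qed

end
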